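(* Let $d \ge 1$. Consider a continuous-time birth-and-death chain with generator $G^*$ on the state space $\{0, \dots, d\}$ started at $0$. Suppose that $d$ is an absorbing state, and suppose that the other birth rates $\lambda^*_i$, $0 \le i \le d-1$, and death rates $\mu^*_i$, $1 \le i \le d-1$, are (strictly) positive. Then the absorption time in state $d$ is distributed as the sum of $d$ independent exponential random variables whose rate parameters are the $d$ nonzero eigenvalues of $-G^*$.
   Context: A continuous-time birth-and-death generator on $\{0,\dots,d\}$ with birth rates $\lambda^*_i$ and death rates $\mu^*_i$ is the tridiagonal matrix $G^*$ with $G^*(i,i+1)=\lambda^*_i$, $G^*(i,i-1)=\mu^*_i$, $G^*(i,i)=-(\lambda^*_i+\mu^*_i)$, where $\mu^*_0=0$ and $\lambda^*_d=0$. That $d$ is absorbing means that row $d$ of $G^*$ is zero. The absorption time in state $d$ is the first time the chain is in state $d$. Eigenvalues are counted with multiplicity. *)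

theory Defs
  imports "HOL-Probability.Probability" "Jordan_Normal_Form.Char_Poly"
begin

text \<open>Only the values of \<open>lam\<close> and \<open>mu\<close> on \<open>{0..d}\<close> matter; the entry \<open>(0,0)\<close> involves \<open>mu 0\<close>
  and the entry \<open>(d,d)\<close> involves \<open>lam d\<close>, which are zero by convention.\<close>

definition birth_death_generator :: "nat \<Rightarrow> (nat \<Rightarrow> real) \<Rightarrow> (nat \<Rightarrow> real) \<Rightarrow> real mat" where
  "birth_death_generator d lam mu = mat (d + 1) (d + 1) (\<lambda>(i, j).
     if j = i + 1 then lam i
     else if i = j + 1 then mu i
     else if i = j then - (lam i + mu i)
     else 0)"

text \<open>Entry \<open>(i,j)\<close> of the matrix exponential \<open>exp (t G)\<close>.\<close>

definition transition_prob :: "real mat \<Rightarrow> real \<Rightarrow> nat \<Rightarrow> nat \<Rightarrow> real" where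
  "transition_prob G t i j = (\<Sum>n. t ^ n / fact n * (G ^\<^sub>m n) $$ (i, j))"

text \<open>A time-homogeneous continuous-time Markov chain with generator \<open>G\<close> on the finite state space
  \<open>{..<dim_row G}\<close>. Time is \<open>[0,\<infinity>)\<close>; values of \<open>X\<close> at negative times are irrelevant. Paths are
  right-continuous for the discrete topology (the topology of \<^typ>\<open>nat\<close>).\<close>

locale markov_chain = prob_space M for M :: "'a measure" +
  fixes G :: "real mat" and X :: "real \<Rightarrow> 'a \<Rightarrow> nat"
  assumes measurable_state:
      "\<And>t. 0 \<le> t \<Longrightarrow> X t \<in> measurable M (count_space {..<dim_row G})"
    and right_continuous:
      "\<And>\<omega> t. \<omega> \<in> space M \<Longrightarrow> 0 \<le> t \<Longrightarrow> continuous (at_right t) (\<lambda>s. X s \<omega>)"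
    and markov:
      "\<And>n (t :: nat \<Rightarrow> real) (i :: nat \<Rightarrow> nat).
         0 \<le> t 0 \<Longrightarrow> (\<forall>k\<le>n. t k < t (Suc k)) \<Longrightarrow> (\<forall>k\<le>Suc n. i k < dim_row G) \<Longrightarrow>
         \<P>(\<omega> in M. \<forall>k\<le>n. X (t k) \<omega> = i k) > 0 \<Longrightarrow>
         \<P>(\<omega> in M. X (t (Suc n)) \<omega> = i (Suc n) \<bar> \<forall>k\<le>n. X (t k) \<omega> = i k)
           = transition_prob G (t (Suc n) - t n) (i n) (i (Suc n))"

text \<open>The value is \<open>\<infinity>\<close> on paths that never visit \<open>s\<close>; on right-continuous paths the infimum is
  attained otherwise.\<close>

definition absorption_time :: "(real \<Rightarrow> 'a \<Rightarrow> nat) \<Rightarrow> nat \<Rightarrow> 'a \<Rightarrow> ereal" where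
  "absorption_time X s \<omega> = (INF t\<in>{t. 0 \<le> t \<and> X t \<omega> = s}. ereal t)"

text \<open>Complex eigenvalues with algebraic multiplicity.\<close>

definition eigenvalues_mset :: "real mat \<Rightarrow> complex multiset" where
  "eigenvalues_mset A = proots (char_poly (map_mat complex_of_real A))"

end

theory Submission
  imports Defs
begin

text \<open>
  Let \<open>\<psi>\<^sub>k\<close> be the characteristic polynomial of minus the leading \<open>k \<times> k\<close> block of \<open>G\<close>; then
  \<open>x \<psi>\<^sub>d\<close> is that of \<open>- G\<close>. The chain killed at \<open>d\<close> is reversible, and its Dirichlet form is positive,
  so the roots \<open>r\<^sub>0, \<dots>, r\<^bsub>d-1\<^esub>\<close> of \<open>\<psi>\<^sub>d\<close> are positive reals.
  Put \<open>f\<^sub>i(t) = exp(tG)(i,d)\<close>. The three-term recurrence of \<open>\<psi>\<close> and Kolmogorov's backward equation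
  have the same shape, whence \<open>\<psi>\<^sub>k(- d/dt) f\<^sub>0 = (\<Prod>i<k. - \<lambda>\<^sub>i) f\<^sub>k\<close>, and \<open>f\<^sub>d = 1\<close>.
  Therefore the functions \<open>g\<^sub>k = (\<Prod>i<k. 1 + r\<^sub>i\<^sup>-\<^sup>1 d/dt) f\<^sub>0\<close> satisfy \<open>g\<^sub>0 = f\<^sub>0\<close>, \<open>g\<^sub>d = 1\<close>,
  \<open>g\<^sub>k' = r\<^sub>k (g\<^bsub>k+1\<^esub> - g\<^sub>k)\<close> and \<open>g\<^sub>k(0) = 0\<close> for \<open>k < d\<close>. The distribution functions of
  \<open>E\<^sub>k + \<dots> + E\<^bsub>d-1\<^esub>\<close> for independent \<open>E\<^sub>i \<sim> Exp(r\<^sub>i)\<close> obey the same system, and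
  \<open>P(T \<le> t) = P(X\<^sub>t = d) = f\<^sub>0(t)\<close> since \<open>d\<close> is absorbing.
\<close>

section \<open>The spectrum of a birth-and-death generator\<close>

text \<open>Laplace expansion along the last row, then along the last column of the minor that
  remains, gives the three-term recurrence of continuants. Off-diagonal entries enter only through
  the products \<open>b n * c n\<close>.\<close>

lemma det_tridiagonal:
  fixes a b c K :: "nat \<Rightarrow> 'a :: comm_ring_1"
  assumes K0: "K 0 = 1" and K1: "K (Suc 0) = a 0"
    and K2: "\<And>n. K (Suc (Suc n)) = a (Suc n) * K (Suc n) - b n * c n * K n"
  shows "det (mat n n (\<lambda>(i, j). if j = Suc i then b i else if i = Suc j then c j
                                else if i = j then a i else 0)) = K n"
proof -
  define T where "T n = mat n n (\<lambda>(i, j). if j = Suc i then b i else if i = Suc j then c j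
                                else if i = j then a i else 0)" for n
  have T_carrier: "T n \<in> carrier_mat n n" for n by (simp add: T_def)
  have T_last: "det (T (Suc (Suc n))) = a (Suc n) * det (T (Suc n)) - b n * c n * det (T n)" for n
  proof -
    define A where "A = T (Suc (Suc n))"
    define B where "B = mat_delete A (Suc n) n"
    have A: "A \<in> carrier_mat (Suc (Suc n)) (Suc (Suc n))" by (simp add: A_def T_carrier)
    have B: "B \<in> carrier_mat (Suc n) (Suc n)" using mat_delete_carrier[OF A] by (simp add: B_def)
    have "det A = (\<Sum>j<Suc (Suc n). A $$ (Suc n, j) * cofactor A (Suc n) j)"
      by (rule laplace_expansion_row[OF A]) simp
    also have "\<dots> = A $$ (Suc n, n) * cofactor A (Suc n) n
        + A $$ (Suc n, Suc n) * cofactor A (Suc n) (Suc n)"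
      by (auto simp: A_def T_def intro!: sum.neutral)
    also have "A $$ (Suc n, n) = c n" by (simp add: A_def T_def)
    also have "A $$ (Suc n, Suc n) = a (Suc n)" by (simp add: A_def T_def)
    also have "mat_delete A (Suc n) (Suc n) = T (Suc n)"
      by (rule eq_matI) (auto simp: mat_delete_def A_def T_def)
    then have "cofactor A (Suc n) (Suc n) = det (T (Suc n))" by (simp add: cofactor_def)
    also have "cofactor A (Suc n) n = - det B" by (simp add: cofactor_def B_def)
    also have "det B = (\<Sum>i<Suc n. B $$ (i, n) * cofactor B i n)"
      by (rule laplace_expansion_column[OF B]) simp
    also have "\<dots> = B $$ (n, n) * cofactor B n n"
      by (auto simp: B_def A_def T_def mat_delete_def intro!: sum.neutral)
    also have "B $$ (n, n) = b n" by (simp add: B_def A_def T_def mat_delete_def)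
    also have "mat_delete B n n = T n"
      by (rule eq_matI) (auto simp: mat_delete_def A_def B_def T_def)
    then have "cofactor B n n = det (T n)" by (simp add: cofactor_def)
    finally show ?thesis by (simp add: A_def algebra_simps)
  qed
  have "det (T n) = K n \<and> det (T (Suc n)) = K (Suc n)"
  proof (induction n)
    case 0
    then show ?case using K0 K1 by (simp add: T_def det_single det_dim_zero)
  next
    case (Suc n)
    then show ?case by (simp add: T_last K2)
  qed
  then show ?thesis by (simp add: T_def)
qed

text \<open>The characteristic polynomial of minus the leading principal \<open>k \<times> k\<close> block of the generator.\<close>

fun bd_poly :: "(nat \<Rightarrow> real) \<Rightarrow> (nat \<Rightarrow> real) \<Rightarrow> nat \<Rightarrow> real poly" where
  "bd_poly l m 0 = 1"
| "bd_poly l m (Suc 0) = [:- (l 0 + m 0), 1:]"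
| "bd_poly l m (Suc (Suc k)) =
     [:- (l (Suc k) + m (Suc k)), 1:] * bd_poly l m (Suc k) - [:l k * m (Suc k):] * bd_poly l m k"

lemma char_poly_uminus_birth_death_generator:
  "char_poly (- birth_death_generator d l m) = bd_poly l m (Suc d)"
proof -
  \<comment> \<open>The matrix under the determinant is \<open>x I + G\<close>, so the rates appear
    off the diagonal without a sign.\<close>
  have "char_poly_matrix (- birth_death_generator d l m) = mat (Suc d) (Suc d) (\<lambda>(i, j).
      if j = Suc i then [:l i:] else if i = Suc j then [:m (Suc j):]
      else if i = j then [:- (l i + m i), 1:] else 0)"
    by (rule eq_matI) (auto simp: char_poly_matrix_def birth_death_generator_def)
  then show ?thesis
    unfolding char_poly_def by (simp only:) (rule det_tridiagonal, auto)
qed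

lemma degree_bd_poly: "degree (bd_poly l m k) = k"
  and lead_coeff_bd_poly: "lead_coeff (bd_poly l m k) = 1"
proof -
  have "degree (bd_poly l m k) = k \<and> coeff (bd_poly l m k) k = 1"
  proof (cases k)
    case (Suc d)
    have "- birth_death_generator d l m \<in> carrier_mat (Suc d) (Suc d)"
      by (simp add: birth_death_generator_def)
    from degree_monic_char_poly[OF this] show ?thesis
      unfolding char_poly_uminus_birth_death_generator Suc .
  qed simp
  then show "degree (bd_poly l m k) = k" "lead_coeff (bd_poly l m k) = 1" by auto
qed

text \<open>At 0 the death rates cancel: inductively the value at \<open>k + 1\<close> is
  \<open>- l k\<close> times the value at \<open>k\<close>, so both terms of the recurrence that
  contain \<open>m (k + 1)\<close> annihilate each other.\<close>

lemma poly_bd_poly_0: "m 0 = 0 \<Longrightarrow> poly (bd_poly l m k) 0 = (\<Prod>i<k. - l i)"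
  by (induction l m k rule: bd_poly.induct) (auto simp: algebra_simps)

text \<open>A root yields an eigenvector of the killed generator that is 1 at state 0 and 0 at
  \<open>d\<close>. Its Rayleigh quotient \<open>S d / V d\<close> equals \<open>z\<close>; both
  sums are positive reals, so reality and positivity come together.\<close>

lemma bd_poly_root_positive:
  fixes z :: complex
  assumes m0: "m 0 = 0" and l: "\<And>i. i < d \<Longrightarrow> 0 < l i" and m: "\<And>i. 0 < i \<Longrightarrow> i < d \<Longrightarrow> 0 < m i"
    and z: "poly (map_poly complex_of_real (bd_poly l m d)) z = 0"
  shows "\<exists>x>0. z = complex_of_real x"
proof -
  interpret map_poly: map_poly_comm_ring_hom complex_of_real ..
  define \<psi> where "\<psi> k = poly (map_poly complex_of_real (bd_poly l m k)) z" for k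
  define W where "W k = (\<Prod>i<k. - l i)" for k
  text \<open>\<open>v\<close> is an eigenvector of the killed generator, \<open>w\<close> its reversing measure, \<open>c\<close> the edge conductances.\<close>
  define v where "v k = \<psi> k / complex_of_real (W k)" for k
  define w where "w k = (\<Prod>i<k. l i / m (Suc i))" for k
  define D where "D k = v (Suc k) - v k" for k
  define c where "c k = w k * l k" for k
  have W: "W k \<noteq> 0" if "k \<le> d" for k using l that unfolding W_def by (auto simp: prod_zero_iff) (metis less_irrefl less_le_trans)
  have w_pos: "0 < w k" if "k < d" for k
    using l m that by (auto simp: w_def intro!: prod_pos divide_pos_pos)
  have v0: "v 0 = 1" by (simp add: v_def \<psi>_def W_def)
  have vd: "v d = 0" using z by (simp add: v_def \<psi>_def)
  have \<psi>1: "\<psi> (Suc 0) = z - l 0 - m 0" by (simp add: \<psi>_def)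
  have const: "poly (map_poly complex_of_real [:x:]) z = x" for x
    by (cases "x = 0") (simp_all add: map_poly_pCons)
  have \<psi>2: "\<psi> (Suc (Suc k)) = (z - l (Suc k) - m (Suc k)) * \<psi> (Suc k) - l k * m (Suc k) * \<psi> k" for k
    unfolding \<psi>_def bd_poly.simps map_poly.hom_minus map_poly.hom_mult by (simp add: const algebra_simps)
  \<comment> \<open>The eigenvalue equation \<open>- G v = z v\<close>, multiplied by
    \<open>w\<close>, becomes a balance of flows: detailed balance
    \<open>w k * l k = w (k + 1) * m (k + 1)\<close> makes \<open>c k\<close> the conductance of the
    edge from \<open>k\<close> to \<open>k + 1\<close>.\<close>
  have harmonic0: "c 0 * D 0 = - (z * v 0)" if "0 < d"
    using l[OF that] by (simp add: c_def w_def D_def v_def \<psi>1 W_def m0 field_simps) (simp add: \<psi>_def)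
  have harmonic: "c (Suc k) * D (Suc k) - c k * D k = - (z * w (Suc k) * v (Suc k))" if "Suc k < d" for k
  proof -
    have nz: "complex_of_real (l k) \<noteq> 0" "complex_of_real (l (Suc k)) \<noteq> 0" "complex_of_real (m (Suc k)) \<noteq> 0"
        "complex_of_real (W k) \<noteq> 0"
      using l[of k] l[of "Suc k"] m[of "Suc k"] W[of k] that by auto
    have ws: "w (Suc k) = w k * l k / m (Suc k)" by (simp add: w_def)
    have Ws: "W (Suc k) = - W k * l k" "W (Suc (Suc k)) = W k * l k * l (Suc k)" by (simp_all add: W_def)
    show ?thesis using nz
      by (simp add: c_def D_def v_def \<psi>2 ws Ws divide_simps) (simp add: algebra_simps)
  qed
  define S where "S n = (\<Sum>k<n. c k * (cmod (D k))\<^sup>2)" for n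
  define V where "V n = (\<Sum>k<n. w k * (cmod (v k))\<^sup>2)" for n
  have norm_sq: "(complex_of_real (cmod y))\<^sup>2 = y * cnj y" for y
    using complex_norm_square[of y] by simp
  text \<open>Summation by parts: the Dirichlet form of \<open>v\<close>, with the boundary term at \<open>n\<close>.\<close>
  have parts: "z * V (Suc n) = S (Suc n) - cnj (v (Suc n)) * c n * D n" if "n < d" for n
    using that
  proof (induction n)
    case 0
    have "z * V 1 = cnj (v 0) * (z * v 0)" by (simp add: V_def v0 w_def)
    also have "\<dots> = - cnj (v 0) * (c 0 * D 0)" using harmonic0 0 by simp
    also have "\<dots> = c 0 * (D 0 * cnj (D 0)) - cnj (v 1) * c 0 * D 0"
      by (simp add: D_def algebra_simps)
    finally show ?case by (simp add: S_def norm_sq)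
  next
    case (Suc n)
    have "z * V (Suc (Suc n)) = z * V (Suc n) + z * w (Suc n) * (v (Suc n) * cnj (v (Suc n)))"
      by (simp add: V_def norm_sq algebra_simps)
    also have "\<dots> = z * V (Suc n) - cnj (v (Suc n)) * (c (Suc n) * D (Suc n) - c n * D n)"
      unfolding harmonic[OF Suc.prems] by (simp add: algebra_simps)
    also have "\<dots> = S (Suc n) - cnj (v (Suc n)) * c (Suc n) * D (Suc n)"
      using Suc by (simp add: algebra_simps)
    \<comment> \<open>Since \<open>D (n + 1) = v (n + 2) - v (n + 1)\<close>, moving the boundary
      term up by one index releases the next squared increment.\<close>
    also have "\<dots> = S (Suc n) + c (Suc n) * (D (Suc n) * cnj (D (Suc n)))
        - cnj (v (Suc (Suc n))) * c (Suc n) * D (Suc n)"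
      by (simp add: D_def algebra_simps)
    finally show ?case by (simp add: S_def norm_sq)
  qed
  have "d \<noteq> 0" using v0 vd by (cases d) auto
  then obtain n where n: "d = Suc n" by (cases d) auto
  have zV: "z * V d = S d" using parts[of n] vd by (simp add: n)
  have "V d \<ge> w 0 * (cmod (v 0))\<^sup>2" unfolding V_def
    using w_pos n by (intro member_le_sum) (auto intro!: mult_nonneg_nonneg simp: less_imp_le)
  then have V: "0 < V d" by (simp add: v0 w_def)
  have c: "0 < c k" if "k < d" for k using w_pos l that by (simp add: c_def)
  \<comment> \<open>The Dirichlet form vanishes only on constants, while \<open>v\<close> passes
    from 1 to 0.\<close>
  have "\<exists>k<d. D k \<noteq> 0"
  proof (rule ccontr)
    assume "\<not> ?thesis"
    then have "k \<le> d \<Longrightarrow> v k = 1" for k by (induction k) (auto simp: v0 D_def)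
    then show False using vd by force
  qed
  then have S: "0 < S d" unfolding S_def
    using c by (auto intro!: sum_pos2 simp: less_imp_le)
  have "z = complex_of_real (S d / V d)" using zV V by (simp add: field_simps)
  then show ?thesis using S V by (intro exI[of _ "S d / V d"]) auto
qed

text \<open>One enumeration \<open>r\<close> of the roots serves two purposes: the multiset
  describes the spectrum, and the product splits the differential operator into first-order
  factors.\<close>

lemma real_rooted_factorization:
  fixes p :: "real poly"
  assumes roots: "\<And>z. poly (map_poly complex_of_real p) z = 0 \<Longrightarrow> \<exists>x. P x \<and> z = complex_of_real x"
    and monic: "lead_coeff p = 1"
  obtains r where "proots (map_poly complex_of_real p) = {#complex_of_real (r k). k \<in># mset_set {..<degree p}#}"
    and "\<And>k. k < degree p \<Longrightarrow> P (r k)"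
    and "p = (\<Prod>k<degree p. [:- r k, 1:])"
proof -
  interpret map_poly: map_poly_comm_ring_hom complex_of_real ..
  let ?p = "map_poly complex_of_real p"
  have p: "?p \<noteq> 0" "degree ?p = degree p" "lead_coeff ?p = 1"
    using monic by (auto simp: coeff_map_poly)
  obtain xs where xs: "mset xs = proots ?p" using ex_mset by blast
  have len: "length xs = degree p"
    using size_proots_complex[of ?p] p by (simp flip: xs)
  have root: "P (Re z) \<and> z = complex_of_real (Re z)" if "z \<in> set xs" for z
  proof -
    have "z \<in># proots ?p" using that by (simp flip: xs)
    then show ?thesis using roots[of z] p by auto
  qed
  define r where "r k = Re (xs ! k)" for k
  have r: "xs ! k = complex_of_real (r k)" "P (r k)" if "k < degree p" for k
    using root[of "xs ! k"] that len by (auto simp: r_def)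
  have "mset xs = mset (map ((!) xs) [0..<degree p])" by (simp add: map_nth flip: len)
  also have "\<dots> = {#xs ! k. k \<in># mset_set {..<degree p}#}" by (simp add: lessThan_atLeast0)
  also have "\<dots> = {#complex_of_real (r k). k \<in># mset_set {..<degree p}#}"
    using r by (intro image_mset_cong) auto
  finally have roots_r: "proots ?p = {#complex_of_real (r k). k \<in># mset_set {..<degree p}#}" by (simp add: xs)
  have map_prod: "map_poly complex_of_real (\<Prod>k<n. [:- r k, 1:]) = (\<Prod>k<n. [:- complex_of_real (r k), 1:])" for n
    by (simp add: map_poly.hom_prod)
  have "?p = (\<Prod>x\<in>#proots ?p. [:- x, 1:])"
    using complex_poly_decompose_multiset[of ?p] p by simp
  also have "\<dots> = (\<Prod>k<degree p. [:- complex_of_real (r k), 1:])"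
    unfolding roots_r by (simp add: image_mset.compositionality o_def prod_unfold_prod_mset)
  finally have "?p = map_poly complex_of_real (\<Prod>k<degree p. [:- r k, 1:])" by (simp add: map_prod)
  then have "p = (\<Prod>k<degree p. [:- r k, 1:])"
    by (auto simp: poly_eq_iff coeff_map_poly)
  then show ?thesis using that roots_r r by blast
qed

section \<open>Transition functions\<close>

text \<open>The exponential generating function of \<open>c\<close>: differentiation becomes a shift
  of the coefficients, and the powers of a matrix give the entries of its exponential.\<close>

definition egf :: "(nat \<Rightarrow> real) \<Rightarrow> real \<Rightarrow> real" where
  "egf c t = (\<Sum>k. c k / fact k * t ^ k)"

lemma egf_0: "egf c 0 = c 0"
  using powser_zero[of "\<lambda>k. c k / fact k"] by (simp add: egf_def)

context
  fixes c :: "nat \<Rightarrow> real" and B C :: real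
  assumes bound: "\<And>k. \<bar>c k\<bar> \<le> B * C ^ k"
begin

lemma summable_egf: "summable (\<lambda>k. c k / fact k * t ^ k)"
proof (rule summable_comparison_test')
  show "summable (\<lambda>k. \<bar>B\<bar> * (inverse (fact k) * (\<bar>C\<bar> * \<bar>t\<bar>) ^ k))"
    by (intro summable_mult summable_exp)
next
  fix k
  have "\<bar>c k\<bar> \<le> \<bar>B\<bar> * \<bar>C\<bar> ^ k"
    using order_trans[OF bound abs_ge_self] by (simp add: abs_mult power_abs)
  then have "\<bar>c k\<bar> * (\<bar>t\<bar> ^ k / fact k) \<le> (\<bar>B\<bar> * \<bar>C\<bar> ^ k) * (\<bar>t\<bar> ^ k / fact k)"
    by (rule mult_right_mono) simp
  then show "norm (c k / fact k * t ^ k) \<le> \<bar>B\<bar> * (inverse (fact k) * (\<bar>C\<bar> * \<bar>t\<bar>) ^ k)"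
    by (simp add: abs_mult power_abs power_mult_distrib divide_inverse mult_ac)
qed

lemma has_real_derivative_egf: "(egf c has_real_derivative egf (\<lambda>k. c (Suc k)) t) (at t)"
proof -
  have "diffs (\<lambda>k. c k / fact k) = (\<lambda>k. c (Suc k) / fact k)"
    by (auto simp: diffs_def fun_eq_iff fact_Suc simp del: of_nat_Suc)
  then show ?thesis
    using termdiffs_strong_converges_everywhere[OF summable_egf, of t] by (simp add: egf_def[abs_def])
qed

end

lemma egf_sum:
  assumes "finite I" and "\<And>i k. i \<in> I \<Longrightarrow> \<bar>c i k\<bar> \<le> B * C ^ k"
  shows "egf (\<lambda>k. \<Sum>i\<in>I. a i * c i k) t = (\<Sum>i\<in>I. a i * egf (c i) t)"
proof -
  have "egf (\<lambda>k. \<Sum>i\<in>I. a i * c i k) t = (\<Sum>k. \<Sum>i\<in>I. a i * (c i k / fact k * t ^ k))"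
    by (simp add: egf_def sum_divide_distrib sum_distrib_right mult.assoc)
  also have "\<dots> = (\<Sum>i\<in>I. \<Sum>k. a i * (c i k / fact k * t ^ k))"
    by (rule suminf_sum) (intro summable_mult summable_egf[of _ B C] assms)
  also have "\<dots> = (\<Sum>i\<in>I. a i * egf (c i) t)"
    unfolding egf_def by (intro sum.cong refl suminf_mult summable_egf[of _ B C] assms)
  finally show ?thesis .
qed

section \<open>Entries of the matrix exponential\<close>

lemma transition_prob_eq_egf: "transition_prob G t i j = egf (\<lambda>k. (G ^\<^sub>m k) $$ (i, j)) t"
  by (simp add: transition_prob_def egf_def mult_ac)

lemma mat_mult_entry:
  "A \<in> carrier_mat n n \<Longrightarrow> B \<in> carrier_mat n n \<Longrightarrow> i < n \<Longrightarrow> j < n \<Longrightarrow>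
    (A * B) $$ (i, j) = (\<Sum>k<n. A $$ (i, k) * B $$ (k, j))"
  by (simp add: scalar_prod_def lessThan_atLeast0)

lemma pow_mat_Suc_left:
  "A \<in> carrier_mat n n \<Longrightarrow> A ^\<^sub>m Suc k = A * A ^\<^sub>m k"
  by (induction k) (simp_all add: assoc_mult_mat[of _ n n _ n _ n])

lemma pow_mat_entries_bounded:
  fixes A :: "real mat"
  assumes A: "A \<in> carrier_mat n n"
  obtains C where "\<And>k i j. i < n \<Longrightarrow> j < n \<Longrightarrow> \<bar>(A ^\<^sub>m k) $$ (i, j)\<bar> \<le> C ^ k"
proof
  \<comment> \<open>The sum of all absolute entries dominates every column sum, which is what one
    more factor on the right contributes.\<close>
  define C where "C = (\<Sum>i<n. \<Sum>j<n. \<bar>A $$ (i, j)\<bar>)"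
  fix k i j
  assume "i < n" "j < n"
  then show "\<bar>(A ^\<^sub>m k) $$ (i, j)\<bar> \<le> C ^ k"
  proof (induction k arbitrary: j)
    case 0
    then show ?case using A by simp
  next
    case (Suc k)
    have "C \<ge> 0" by (auto simp: C_def intro!: sum_nonneg)
    have "\<bar>(A ^\<^sub>m Suc k) $$ (i, j)\<bar> \<le> (\<Sum>p<n. \<bar>(A ^\<^sub>m k) $$ (i, p)\<bar> * \<bar>A $$ (p, j)\<bar>)"
      using mat_mult_entry[OF pow_carrier_mat[OF A] A] Suc.prems
      by (simp add: abs_mult[symmetric] sum_abs)
    also have "\<dots> \<le> (\<Sum>p<n. C ^ k * \<bar>A $$ (p, j)\<bar>)"
      using Suc by (intro sum_mono mult_right_mono) auto
    also have "\<dots> = C ^ k * (\<Sum>p<n. \<bar>A $$ (p, j)\<bar>)" by (simp add: sum_distrib_left)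
    also have "\<dots> \<le> C ^ k * C"
      unfolding C_def using \<open>C \<ge> 0\<close> Suc.prems
      by (intro mult_left_mono sum_mono member_le_sum) (auto simp: C_def)
    finally show ?case by (simp add: mult.commute)
  qed
qed

text \<open>Kolmogorov's backward equation: the shifted coefficients are the entries of
  \<open>A ^\<^sub>m Suc k\<close>, from which one factor \<open>A\<close> is split off on the
  left.\<close>

lemma transition_prob_has_real_derivative:
  assumes A: "A \<in> carrier_mat n n" and i: "i < n" and j: "j < n"
  shows "((\<lambda>t. transition_prob A t i j) has_real_derivative
    (\<Sum>k<n. A $$ (i, k) * transition_prob A t k j)) (at t)"
proof -
  obtain C where C: "\<And>k i j. i < n \<Longrightarrow> j < n \<Longrightarrow> \<bar>(A ^\<^sub>m k) $$ (i, j)\<bar> \<le> C ^ k"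
    using pow_mat_entries_bounded[OF A] by blast
  have "((\<lambda>t. transition_prob A t i j) has_real_derivative egf (\<lambda>k. (A ^\<^sub>m Suc k) $$ (i, j)) t) (at t)"
    unfolding transition_prob_eq_egf using C i j
    by (intro has_real_derivative_egf[of _ 1 C]) auto
  also have "(\<lambda>k. (A ^\<^sub>m Suc k) $$ (i, j)) = (\<lambda>k. \<Sum>p<n. A $$ (i, p) * (A ^\<^sub>m k) $$ (p, j))"
    using mat_mult_entry[OF A pow_carrier_mat[OF A] i j] pow_mat_Suc_left[OF A] by auto
  also have "egf \<dots> t = (\<Sum>p<n. A $$ (i, p) * transition_prob A t p j)"
    unfolding transition_prob_eq_egf using C j by (intro egf_sum[of _ _ 1 C]) auto
  finally show ?thesis .
qed

text \<open>The linear extension of \<open>x ^ n\<close> to \<open>F n t\<close>. If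
  \<open>F n\<close> is the n-th power of an operator applied to a function, this is a polynomial in
  that operator applied to the function, and multiplication by \<open>x\<close> is a shift of
  \<open>F\<close>.\<close>

definition poly_comb :: "(nat \<Rightarrow> 'a \<Rightarrow> real) \<Rightarrow> real poly \<Rightarrow> 'a \<Rightarrow> real" where
  "poly_comb F p t = (\<Sum>n\<le>degree p. coeff p n * F n t)"

text \<open>A common summation bound allows polynomials of different degrees to be added, also when
  the degree of the sum drops.\<close>

lemma poly_comb_upto: "degree p \<le> N \<Longrightarrow> poly_comb F p t = (\<Sum>n\<le>N. coeff p n * F n t)"
  unfolding poly_comb_def by (rule sum.mono_neutral_left) (auto simp: coeff_eq_0)

lemma poly_comb_1: "poly_comb F 1 t = F 0 t"
  by (simp add: poly_comb_def)

lemma poly_comb_add: "poly_comb F (p + q) t = poly_comb F p t + poly_comb F q t"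
  using degree_add_le_max[of p q]
  by (simp add: poly_comb_upto[of _ "max (degree p) (degree q)"] sum.distrib algebra_simps)

lemma poly_comb_smult: "poly_comb F (Polynomial.smult c p) t = c * poly_comb F p t"
  by (simp add: poly_comb_upto[of _ "degree p"] sum_distrib_left mult.assoc)

lemma poly_comb_pCons_0: "poly_comb F (pCons 0 p) t = (\<Sum>n\<le>degree p. coeff p n * F (Suc n) t)"
  by (subst poly_comb_upto[of _ "Suc (degree p)"])
    (auto simp: degree_pCons_le sum.atMost_Suc_shift simp del: sum.atMost_Suc)

text \<open>Splits off one linear factor, both in the recurrence of \<open>bd_poly\<close> and in
  the product over the roots.\<close>

lemma poly_comb_linear_mult:
  "poly_comb F ([:a, b:] * p) t = a * poly_comb F p t + b * poly_comb F (pCons 0 p) t"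
proof -
  have "[:a, b:] * p = Polynomial.smult a p + Polynomial.smult b (pCons 0 p)" by simp
  then show ?thesis by (simp only: poly_comb_add poly_comb_smult)
qed

lemma has_real_derivative_poly_comb:
  assumes "\<And>n. (F n has_real_derivative - F (Suc n) t) (at t)"
  shows "(poly_comb F p has_real_derivative - poly_comb F (pCons 0 p) t) (at t)"
  unfolding poly_comb_def[of F p, abs_def] poly_comb_pCons_0 sum_negf[symmetric]
  by (auto intro!: derivative_eq_intros assms sum.cong)

section \<open>Rows and powers of the generator, and the first-order system for the hitting
  probability\<close>

lemma birth_death_generator_carrier: "birth_death_generator d l m \<in> carrier_mat (Suc d) (Suc d)"
  by (simp add: birth_death_generator_def)

lemma birth_death_generator_row_sum:
  assumes "k < d"
  shows "(\<Sum>j<Suc d. birth_death_generator d l m $$ (k, j) * v j) =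
    l k * v (Suc k) - (l k + m k) * v k + (if k = 0 then 0 else m k * v (k - 1))"
proof -
  have "(\<Sum>j<Suc d. birth_death_generator d l m $$ (k, j) * v j) =
    (\<Sum>j<Suc d. (if j = Suc k then l k * v j else 0) + (if j = k then - (l k + m k) * v j else 0)
       + (if j = k - 1 then if k = 0 then 0 else m k * v j else 0))"
    using assms by (intro sum.cong refl) (auto simp: birth_death_generator_def)
  also have "\<dots> = l k * v (Suc k) - (l k + m k) * v k + (if k = 0 then 0 else m k * v (k - 1))"
    using assms unfolding sum.distrib
    by (auto simp: less_imp_diff_less algebra_simps simp del: sum.lessThan_Suc)
  finally show ?thesis .
qed

text \<open>One step raises the state by at most one, so \<open>j\<close> cannot be reached from 0
  in fewer than \<open>j\<close> steps. For \<open>j = d\<close> this makes the derivatives of order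
  below \<open>d\<close> of the hitting probability vanish at time 0.\<close>

lemma birth_death_pow_zero:
  "j \<le> d \<Longrightarrow> k < j \<Longrightarrow> (birth_death_generator d l m ^\<^sub>m k) $$ (0, j) = 0"
proof (induction k arbitrary: j)
  case 0
  then show ?case by (simp add: birth_death_generator_def)
next
  case (Suc k)
  let ?G = "birth_death_generator d l m"
  have "(?G ^\<^sub>m Suc k) $$ (0, j) = (\<Sum>p<Suc d. (?G ^\<^sub>m k) $$ (0, p) * ?G $$ (p, j))"
    unfolding pow_mat.simps using Suc.prems
    by (intro mat_mult_entry pow_carrier_mat birth_death_generator_carrier) auto
  also have "\<dots> = 0"
  proof (rule sum.neutral, rule)
    fix p assume "p \<in> {..<Suc d}"
    then show "(?G ^\<^sub>m k) $$ (0, p) * ?G $$ (p, j) = 0"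
      using Suc.IH[of p] Suc.prems by (cases "k < p") (auto simp: birth_death_generator_def)
  qed
  finally show ?case .
qed

text \<open>A zero row of \<open>A\<close> is a zero row of every positive power, so only the
  constant term of the exponential series survives.\<close>

lemma transition_prob_absorbing_state:
  assumes A: "A \<in> carrier_mat n n" and i: "i < n" and row: "\<And>j. j < n \<Longrightarrow> A $$ (i, j) = 0"
  shows "transition_prob A t i i = 1"
proof -
  have "(A ^\<^sub>m k) $$ (i, i) = (if k = 0 then 1 else 0)" for k
    using pow_mat_Suc_left[OF A] mat_mult_entry[OF A pow_carrier_mat[OF A] i i] row A i
    by (cases k) (auto simp del: pow_mat.simps(2))
  then have "transition_prob A t i i = egf (\<lambda>k. if k = 0 then 1 else 0) t"
    by (simp add: transition_prob_eq_egf)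
  also have "\<dots> = (\<Sum>k. if k = 0 then 1 else 0)"
    unfolding egf_def by (rule arg_cong[where f = suminf]) auto
  also have "\<dots> = 1" by (rule sums_unique[symmetric]) (rule sums_single)
  finally show ?thesis .
qed

text \<open>Rescaling the factors \<open>x - r k\<close> to constant term 1 and applying them one at
  a time to \<open>f 0\<close> replaces an equation of order \<open>d\<close> by a chain of
  first-order equations.\<close>

lemma transition_prob_factorization:
  fixes d :: nat and l m r :: "nat \<Rightarrow> real"
  defines "G \<equiv> birth_death_generator d l m"
  assumes m0: "m 0 = 0" and ld: "l d = 0" and md: "m d = 0"
    and l: "\<And>i. i < d \<Longrightarrow> 0 < l i"
    and r: "\<And>k. k < d \<Longrightarrow> 0 < r k"
    and factor: "bd_poly l m d = (\<Prod>k<d. [:- r k, 1:])"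
  obtains g :: "nat \<Rightarrow> real \<Rightarrow> real" where "g 0 = (\<lambda>t. transition_prob G t 0 d)"
    and "\<And>t. g d t = 1"
    and "\<And>k. k < d \<Longrightarrow> g k 0 = 0"
    and "\<And>k t. k < d \<Longrightarrow> (g k has_real_derivative r k * (g (Suc k) t - g k t)) (at t)"
proof -
  have G: "G \<in> carrier_mat (Suc d) (Suc d)" by (simp add: G_def birth_death_generator_carrier)
  define f where "f i t = transition_prob G t i d" for i t
  text \<open>\<open>F n\<close> is the \<open>n\<close>-th power of \<open>- d/dt\<close> applied to \<open>f 0\<close>,
    so \<open>poly_comb F p\<close> is \<open>p (- d/dt)\<close> applied to \<open>f 0\<close>.\<close>
  define F where "F n t = (- 1) ^ n * egf (\<lambda>k. (G ^\<^sub>m (k + n)) $$ (0, d)) t" for n t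
  define W where "W k = (\<Prod>i<k. - l i)" for k
  have W_nz: "W k \<noteq> 0" if "k \<le> d" for k
    using l that unfolding W_def by (auto simp: prod_zero_iff) (metis less_irrefl less_le_trans)
  obtain C where C: "\<And>k i j. i < Suc d \<Longrightarrow> j < Suc d \<Longrightarrow> \<bar>(G ^\<^sub>m k) $$ (i, j)\<bar> \<le> C ^ k"
    using pow_mat_entries_bounded[OF G] by blast
  have F_deriv: "(F n has_real_derivative - F (Suc n) t) (at t)" for n t
  proof -
    have "\<bar>(G ^\<^sub>m (k + n)) $$ (0, d)\<bar> \<le> C ^ n * C ^ k" for k
      using C[of 0 d "k + n"] by (simp add: power_add mult.commute)
    from has_real_derivative_egf[OF this] show ?thesis
      unfolding F_def by (auto intro!: derivative_eq_intros)
  qed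
  note comb_deriv = has_real_derivative_poly_comb[of F, OF F_deriv]
  have f_deriv: "(f k has_real_derivative
      l k * f (Suc k) t - (l k + m k) * f k t + (if k = 0 then 0 else m k * f (k - 1) t)) (at t)"
    if "k < d" for k t
    using transition_prob_has_real_derivative[OF G, of k d t] that
    unfolding f_def G_def birth_death_generator_row_sum[OF that] by simp
  have f_last: "f d t = 1" for t
    unfolding f_def using ld md
    by (intro transition_prob_absorbing_state[OF G]) (auto simp: G_def birth_death_generator_def)
  \<comment> \<open>Differentiate the identity for \<open>k\<close> and insert the backward
    equation: the \<open>f k\<close> terms cancel against the constant coefficient
    \<open>- (l k + m k)\<close>, and \<open>- l k * W k\<close> is
    \<open>W (k + 1)\<close>.\<close>
  have comb_step: "poly_comb F ([:- (l k + m k), 1:] * bd_poly l m k) t =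
      W (Suc k) * f (Suc k) t - (if k = 0 then 0 else W k * m k * f (k - 1) t)"
    if k: "k < d" and IH: "\<And>t. poly_comb F (bd_poly l m k) t = W k * f k t" for k t
  proof -
    have "poly_comb F (bd_poly l m k) = (\<lambda>t. W k * f k t)" using IH by auto
    with comb_deriv[of "bd_poly l m k" t]
    have "((\<lambda>t. W k * f k t) has_real_derivative - poly_comb F (pCons 0 (bd_poly l m k)) t) (at t)" by simp
    from DERIV_unique[OF this DERIV_cmult[OF f_deriv[OF k]]] IH show ?thesis
      unfolding poly_comb_linear_mult by (simp add: W_def algebra_simps)
  qed
  \<comment> \<open>The \<open>f (k - 1)\<close> term left over by \<open>comb_step\<close> is what
    the second term of the recurrence of \<open>bd_poly\<close> removes.\<close>
  have comb_bd: "k \<le> d \<longrightarrow> (\<forall>t. poly_comb F (bd_poly l m k) t = W k * f k t)" for k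
  proof (induction k rule: induct_nat_012)
    case 0
    show ?case by (simp add: poly_comb_1 F_def W_def f_def transition_prob_eq_egf)
  next
    case 1
    have "poly_comb F (bd_poly l m 0) t = W 0 * f 0 t" for t
      by (simp add: poly_comb_1 F_def W_def f_def transition_prob_eq_egf)
    then show ?case using comb_step[of 0] by auto
  next
    case (ge2 k)
    have *: "poly_comb F (p - [:c:] * q) t = poly_comb F p t - c * poly_comb F q t" for p q c t
      using poly_comb_add[of F p "Polynomial.smult (- c) q" t] poly_comb_smult[of F "- c" q t] by simp
    show ?case
      using comb_step[of "Suc k"] ge2
      by (auto simp: * W_def simp del: mult_pCons_left)
  qed
  \<comment> \<open>Under the substitution of \<open>- d/dt\<close> for \<open>x\<close>, the factor
    \<open>1 - x / r i\<close> becomes \<open>1 + (1 / r i) d/dt\<close>.\<close>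
  define P where "P k = (\<Prod>i<k. [:1, - (1 / r i):])" for k
  define g where "g k = poly_comb F (P k)" for k
  have P_last: "P d = Polynomial.smult (inverse (W d)) (bd_poly l m d)"
  proof -
    \<comment> \<open>Both sides are the value at 0 of \<open>bd_poly l m d\<close>.\<close>
    have "W d = (\<Prod>k<d. - r k)"
      using poly_bd_poly_0[of m l d] m0 by (simp add: W_def factor poly_prod)
    moreover have "P d = (\<Prod>k<d. Polynomial.smult (inverse (- r k)) [:- r k, 1:])"
      unfolding P_def using r by (intro prod.cong) (auto simp: field_simps dest: r)
    ultimately show ?thesis by (simp only: factor prod_smult prod_inversef[symmetric] o_def)
  qed
  show ?thesis
  proof
    show "g 0 = (\<lambda>t. transition_prob G t 0 d)"
      by (auto simp: g_def P_def poly_comb_1 F_def transition_prob_eq_egf)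
    show "g d t = 1" for t
      using comb_bd[of d] W_nz[of d] f_last by (simp add: g_def P_last poly_comb_smult)
    fix k assume k: "k < d"
    have "degree [:1, - (1 / r i):] \<le> 1" for i by simp
    \<comment> \<open>As the degree is at most \<open>k < d\<close>, only derivatives of
      \<open>f 0\<close> of order below \<open>d\<close> occur, and these vanish at 0.\<close>
    then have "degree (P k) \<le> (\<Sum>i<k. 1)"
      unfolding P_def by (intro order_trans[OF degree_prod_sum_le] sum_mono) simp_all
    then show "g k 0 = 0"
      unfolding g_def poly_comb_def using k
      by (intro sum.neutral) (auto simp: F_def egf_0 G_def birth_death_pow_zero)
    fix t
    have "P (Suc k) = [:1, - (1 / r k):] * P k" by (simp add: P_def mult.commute)
    then have "g (Suc k) t = g k t - poly_comb F (pCons 0 (P k)) t / r k"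
      unfolding g_def by (simp only: poly_comb_linear_mult) simp
    then have "- poly_comb F (pCons 0 (P k)) t = r k * (g (Suc k) t - g k t)"
      using r[OF k] by (simp add: field_simps)
    then show "(g k has_real_derivative r k * (g (Suc k) t - g k t)) (at t)"
      using comb_deriv[of "P k" t] by (simp add: g_def)
  qed
qed

section \<open>Sums of independent exponential variables\<close>

text \<open>The coordinates on the product of the exponential laws.\<close>

lemma exists_indep_exponentials:
  fixes r :: "'i \<Rightarrow> real"
  assumes r: "\<And>k. k \<in> I \<Longrightarrow> 0 < r k" and "I \<noteq> {}"
  shows "\<exists>(N :: ('i \<Rightarrow> real) measure). prob_space N \<and> prob_space.indep_vars N (\<lambda>_. borel) (\<lambda>k x. x k) I \<and>
    (\<forall>k\<in>I. distributed N lborel (\<lambda>x. x k) (exponential_density (r k)))"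
proof -
  \<comment> \<open>Rate 1 outside \<open>I\<close> makes every \<open>D k\<close> a probability
    measure.\<close>
  define D where "D k = (density lborel (exponential_density (if k \<in> I then r k else 1)))" for k
  define N where "N = PiM I D"
  have D: "prob_space (D k)" for k using r by (auto simp: D_def intro!: prob_space_exponential_density)
  have sets_D [measurable_cong]: "sets (D k) = sets borel" for k by (simp add: D_def)
  interpret N: prob_space N unfolding N_def by (intro prob_space_PiM D)
  have comp [measurable]: "(\<lambda>x. x k) \<in> borel_measurable N" if "k \<in> I" for k
    unfolding N_def using measurable_component_singleton[OF that, of D]
    by (simp add: measurable_cong_sets[OF refl sets_D])
  have distr: "distr N borel (\<lambda>x. x k) = D k" if "k \<in> I" for k
  proof -
    have "distr N borel (\<lambda>x. x k) = distr N (D k) (\<lambda>x. x k)" by (rule distr_cong) (simp_all add: sets_D)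
    then show ?thesis unfolding N_def using distr_PiM_component[OF D that] by simp
  qed
  have "N.indep_vars (\<lambda>_. borel) (\<lambda>k x. x k) I"
  \<comment> \<open>Independence means that the joint law is the product of the marginals; here the
    joint map is the identity of \<open>N\<close>.\<close>
  proof (subst N.indep_vars_iff_distr_eq_PiM'[OF \<open>I \<noteq> {}\<close>])
    have "distr N (Pi\<^sub>M I (\<lambda>_. borel)) (\<lambda>x. \<lambda>i\<in>I. x i) = distr N N (\<lambda>x. x)"
    proof (rule distr_cong)
      show "sets (Pi\<^sub>M I (\<lambda>_. borel)) = sets N"
        unfolding N_def by (rule sets_PiM_cong) (simp_all add: sets_D)
      show "(\<lambda>i\<in>I. x i) = x" if "x \<in> space N" for x
        using that by (auto simp: N_def space_PiM)
    qed simp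
    also have "\<dots> = N" by (simp add: distr_id)
    also have "\<dots> = Pi\<^sub>M I (\<lambda>i. distr N borel (\<lambda>x. x i))"
      unfolding N_def by (rule PiM_cong) (simp_all add: distr[unfolded N_def])
    finally show "distr N (Pi\<^sub>M I (\<lambda>_. borel)) (\<lambda>x. \<lambda>i\<in>I. x i) = Pi\<^sub>M I (\<lambda>i. distr N borel (\<lambda>x. x i))" .
  qed (use comp in auto)
  moreover have "distributed N lborel (\<lambda>x. x k) (exponential_density (r k))" if "k \<in> I" for k
  proof -
    have "distr N lborel (\<lambda>x. x k) = distr N borel (\<lambda>x. x k)" by (rule distr_cong) simp_all
    then show ?thesis unfolding distributed_def using distr[OF that] comp[OF that] that by (simp add: D_def)
  qed
  ultimately show ?thesis using N.prob_space_axioms by blast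
qed

text \<open>Downward induction from the empty sum at \<open>k = d\<close>. Conditioning on
  \<open>E k\<close> gives a convolution integral, which is the variation-of-constants solution of
  the equation for \<open>g k\<close> with initial value 0.\<close>

lemma (in prob_space) sum_exponential_cdf:
  fixes g :: "nat \<Rightarrow> real \<Rightarrow> real" and r :: "nat \<Rightarrow> real"
  assumes r: "\<And>k. k < d \<Longrightarrow> 0 < r k"
    and indep: "indep_vars (\<lambda>_. borel) E {..<d}"
    and dist: "\<And>k. k < d \<Longrightarrow> distributed M lborel (E k) (exponential_density (r k))"
    and g_last: "\<And>t. g d t = 1"
    and g_0: "\<And>k. k < d \<Longrightarrow> g k 0 = 0"
    and g_deriv: "\<And>k t. k < d \<Longrightarrow> (g k has_real_derivative r k * (g (Suc k) t - g k t)) (at t)"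
    and "k \<le> d"
  shows "prob {x \<in> space M. (\<Sum>i=k..<d. E i x) \<le> t} = (if t < 0 then 0 else g k t)"
  using \<open>k \<le> d\<close>
proof (induction k arbitrary: t rule: inc_induct)
  case base
  then show ?case by (simp add: g_last prob_space)
next
  case (step k)
  let ?X = "E k" and ?Y = "\<lambda>x. \<Sum>i=Suc k..<d. E i x"
  have k: "k < d" by fact
  have E [measurable]: "E i \<in> borel_measurable M" if "i < d" for i
    using dist[OF that] by (simp add: distributed_def)
  have Y [measurable]: "?Y \<in> borel_measurable M" by (rule borel_measurable_sum) (simp add: E)
  have X [measurable]: "?X \<in> borel_measurable M" using k by simp
  have split: "(\<Sum>i=k..<d. E i x) = ?X x + ?Y x" for x using k by (rule sum.atLeast_Suc_lessThan)
  have IH: "emeasure (distr M borel ?Y) {..s} = ennreal (if s < 0 then 0 else g (Suc k) s)" for s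
    using step.IH[of s] by (simp add: emeasure_distr emeasure_eq_measure vimage_def Int_def conj_commute)
  \<comment> \<open>Nonnegativity is inherited from the probability that equals
    \<open>g (Suc k) s\<close> by the induction hypothesis.\<close>
  have g_nonneg: "0 \<le> g (Suc k) s" if "0 \<le> s" for s
    using step.IH[of s] that measure_nonneg[of M "{x \<in> space M. ?Y x \<le> s}"] by simp
  have [measurable]: "g (Suc k) \<in> borel_measurable borel"
  proof (cases "Suc k < d")
    case True
    then show ?thesis
      by (intro borel_measurable_continuous_onI continuous_at_imp_continuous_on ballI DERIV_isCont[OF g_deriv])
  next
    case False
    then have "Suc k = d" using k by simp
    then show ?thesis using g_last by (simp add: g_last[abs_def])
  qed
  have FTC: "(\<integral>\<^sup>+s. ennreal (r k * exp (- s * r k) * g (Suc k) (t - s)) * indicator {0..t} s \<partial>lborel) = ennreal (g k t)"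
    "0 \<le> g k t" if t: "0 \<le> t"
  proof -
    let ?f = "\<lambda>s. r k * exp (- s * r k) * g (Suc k) (t - s)"
    \<comment> \<open>An antiderivative of the convolution integrand: it vanishes at
      \<open>s = t\<close> because \<open>g k 0 = 0\<close>, and at \<open>s = 0\<close> it is
      \<open>- g k t\<close>.\<close>
    let ?F = "\<lambda>s. - exp (- s * r k) * g k (t - s)"
    have f: "?f \<in> borel_measurable borel" by measurable
    have deriv: "(?F has_real_derivative ?f s) (at s)" for s
    proof -
      have "((\<lambda>s. g k (t - s)) has_real_derivative - (r k * (g (Suc k) (t - s) - g k (t - s)))) (at s)"
        by (rule DERIV_chain2[OF g_deriv[OF k], THEN DERIV_cong]) (auto intro!: derivative_eq_intros)
      then show ?thesis by (auto intro!: derivative_eq_intros simp: algebra_simps)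
    qed
    have nonneg: "0 \<le> ?f s" if "s \<in> {0..t}" for s
      using r[OF k] g_nonneg[of "t - s"] that by simp
    have "?F t - ?F 0 = g k t" using g_0[OF k] by simp
    then show "(\<integral>\<^sup>+s. ennreal (?f s) * indicator {0..t} s \<partial>lborel) = ennreal (g k t)"
      using nn_integral_FTC_Icc[OF f deriv nonneg t] by simp
    \<comment> \<open>\<open>ennreal\<close> truncates negative numbers, so the sign of
      \<open>g k t\<close> is established by a Lebesgue integral over the reals.\<close>
    have "(\<integral>s. ?f s * indicator {0..t} s \<partial>lborel) = g k t"
      using integral_FTC_Icc_nonneg[OF f deriv nonneg t] \<open>?F t - ?F 0 = g k t\<close> by simp
    moreover have "0 \<le> (\<integral>s. ?f s * indicator {0..t} s \<partial>lborel)"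
      using nonneg by (intro integral_nonneg_AE) (auto split: split_indicator)
    ultimately show "0 \<le> g k t" by simp
  qed
  have "indep_vars (\<lambda>_. borel) E (insert k {Suc k..<d})"
    by (rule indep_vars_subset[OF indep]) (use k in auto)
  then have "indep_var borel ?X borel ?Y" by (intro indep_vars_sum) auto
  then have "distr M borel (\<lambda>x. ?X x + ?Y x) = convolution (distr M borel ?X) (distr M borel ?Y)"
    by (rule sum_indep_random_variable) simp_all
  then have "emeasure (distr M borel (\<lambda>x. ?X x + ?Y x)) {..t} =
      (\<integral>\<^sup>+s. emeasure (distr M borel ?Y) {a. a + s \<in> {..t}} \<partial>distr M borel ?X)"
    by (simp only:) (rule convolution_emeasure, auto intro!: finite_measure_distr)
  also have "\<dots> = (\<integral>\<^sup>+s. ennreal (if t - s < 0 then 0 else g (Suc k) (t - s)) \<partial>distr M borel ?X)"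
  proof -
    have "{a. a + s \<in> {..t}} = {..t - s}" for s by auto
    then show ?thesis by (simp only: IH)
  qed
  also have "distr M borel ?X = distr M lborel ?X" by (rule distr_cong) simp_all
  also have "\<dots> = density lborel (exponential_density (r k))"
    using dist[OF k] by (simp add: distributed_def)
  also have "(\<integral>\<^sup>+s. ennreal (if t - s < 0 then 0 else g (Suc k) (t - s)) \<partial>\<dots>) =
      (\<integral>\<^sup>+s. ennreal (r k * exp (- s * r k) * g (Suc k) (t - s)) * indicator {0..t} s \<partial>lborel)"
  proof (subst nn_integral_density)
    show "(\<integral>\<^sup>+s. ennreal (exponential_density (r k) s) * ennreal (if t - s < 0 then 0 else g (Suc k) (t - s)) \<partial>lborel) =
      (\<integral>\<^sup>+s. ennreal (r k * exp (- s * r k) * g (Suc k) (t - s)) * indicator {0..t} s \<partial>lborel)"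
    proof (rule nn_integral_cong)
      fix s
      show "ennreal (exponential_density (r k) s) * ennreal (if t - s < 0 then 0 else g (Suc k) (t - s)) =
        ennreal (r k * exp (- s * r k) * g (Suc k) (t - s)) * indicator {0..t} s"
        using r[OF k] g_nonneg[of "t - s"]
        by (cases "s < 0"; cases "t < s") (simp_all add: exponential_density_def ennreal_mult')
    qed
  qed measurable
  also have "\<dots> = ennreal (if t < 0 then 0 else g k t)"
    using FTC(1) by (cases "t < 0") (auto simp: not_less)
  finally have "ennreal (prob {x \<in> space M. (\<Sum>i=k..<d. E i x) \<le> t}) = ennreal (if t < 0 then 0 else g k t)"
    unfolding split by (simp add: emeasure_distr emeasure_eq_measure vimage_def Int_def conj_commute)
  then show ?case using FTC(2) by (subst (asm) ennreal_inj) auto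
qed

text \<open>The closed lower rays form an intersection-stable generator of the Borel sets, and
  \<open>{..\<infinity>}\<close> is already the whole space. Extended reals are the range because an
  absorption time may be infinite.\<close>

lemma ereal_measure_eqI:
  fixes M N :: "ereal measure"
  assumes "prob_space M" "sets M = sets borel" "sets N = sets borel"
    and eq: "\<And>a. emeasure M {..a} = emeasure N {..a}"
  shows "M = N"
proof (rule measure_eqI_generator_eq[where E = "range atMost" and \<Omega> = UNIV and A = "\<lambda>_. {..\<infinity>}"])
  interpret M: prob_space M by fact
  show "Int_stable (range (atMost :: ereal \<Rightarrow> _))" by (auto simp: Int_stable_def)
  show "emeasure M {..\<infinity>} \<noteq> \<infinity>" by simp
  have "borel = sigma UNIV (range (atMost :: ereal \<Rightarrow> _))"
  proof (rule borel_eq_sigmaI1[OF borel_Ioi])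
    fix S :: "ereal set" assume "S \<in> range greaterThan"
    then obtain a where "S = {a<..}" by auto
    then have "S = UNIV - {..a}" by auto
    then show "S \<in> sets (sigma UNIV (range atMost))" by (auto intro!: sigma_sets.Basic sigma_sets.Compl)
  qed simp
  then have "sets (borel :: ereal measure) = sigma_sets UNIV (range atMost)"
    by (metis sets_measure_of subset_UNIV Pow_UNIV)
  then show "sets M = sigma_sets UNIV (range atMost)" "sets N = sigma_sets UNIV (range atMost)"
    using assms by simp_all
qed (use eq in auto)

section \<open>The absorption time of a Markov chain\<close>

text \<open>Convergence in a discrete space means being eventually constant.\<close>

lemma right_continuous_discrete:
  fixes x :: "real \<Rightarrow> 'a :: discrete_topology"
  assumes "continuous (at_right t) x"
  obtains b where "b > t" "\<And>u. t < u \<Longrightarrow> u < b \<Longrightarrow> x u = x t"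
  using assms unfolding continuous_within tendsto_discrete eventually_at_right_field by blast

text \<open>Staying in \<open>s\<close> is assumed along rational times, where countably many null
  sets can be discarded; right-continuity carries it over to all times.\<close>

lemma first_visit_le_iff:
  fixes x :: "real \<Rightarrow> nat"
  assumes rc: "\<And>t. 0 \<le> t \<Longrightarrow> continuous (at_right t) x"
    and stay: "\<And>p q. p \<in> \<rat> \<Longrightarrow> q \<in> \<rat> \<Longrightarrow> 0 \<le> p \<Longrightarrow> p < q \<Longrightarrow> x p = s \<Longrightarrow> x q = s"
    and t: "0 \<le> t"
  shows "(INF t\<in>{t. 0 \<le> t \<and> x t = s}. ereal t) \<le> ereal t \<longleftrightarrow> x t = s"
proof
  assume "x t = s"
  then show "(INF t\<in>{t. 0 \<le> t \<and> x t = s}. ereal t) \<le> ereal t" using t by (intro INF_lower) simp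
next
  assume inf: "(INF t\<in>{t. 0 \<le> t \<and> x t = s}. ereal t) \<le> ereal t"
  have later: "x u = s" if p: "0 \<le> p" "x p = s" "p < u" for p u
  proof -
    obtain b where b: "b > p" "\<And>v. p < v \<Longrightarrow> v < b \<Longrightarrow> x v = x p"
      using right_continuous_discrete[OF rc[OF p(1)]] by blast
    have "0 \<le> u" using p by simp
    obtain c where c: "c > u" "\<And>v. u < v \<Longrightarrow> v < c \<Longrightarrow> x v = x u"
      using right_continuous_discrete[OF rc[OF \<open>0 \<le> u\<close>]] by blast
    \<comment> \<open>The path has the value \<open>x p\<close> at the rational \<open>p'\<close>
      just after \<open>p\<close>, and the value \<open>x u\<close> at the rational
      \<open>q'\<close> just after \<open>u\<close>.\<close>
    obtain p' where p': "p' \<in> \<rat>" "p < p'" "p' < min b u" using Rats_dense_in_real[of p "min b u"] b p by auto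
    obtain q' where q': "q' \<in> \<rat>" "u < q'" "q' < c" using Rats_dense_in_real[OF c(1)] by auto
    have "x q' = s" using stay[of p' q'] p p' q' b(2)[of p'] by auto
    then show ?thesis using c(2) q' by auto
  qed
  obtain b where b: "b > t" "\<And>v. t < v \<Longrightarrow> v < b \<Longrightarrow> x v = x t"
    using right_continuous_discrete[OF rc[OF t]] by blast
  \<comment> \<open>The bound on the infimum yields visits before every time later than
    \<open>t\<close>; \<open>u\<close> is taken so close to \<open>t\<close> that the path has not
    moved in between.\<close>
  obtain u where u: "t < u" "u < b" using dense[OF b(1)] by blast
  have "(INF t\<in>{t. 0 \<le> t \<and> x t = s}. ereal t) < ereal u" using inf u by (auto intro: le_less_trans)
  then obtain p where "0 \<le> p" "x p = s" "p < u" by (auto simp: INF_less_iff)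
  then have "x u = s" by (rule later)
  then show "x t = s" using b(2)[OF u] by simp
qed

lemma absorption_time_nonneg: "0 \<le> absorption_time X s \<omega>"
  unfolding absorption_time_def by (rule INF_greatest) simp

context markov_chain
begin

lemma state_sets [measurable]: "0 \<le> t \<Longrightarrow> s < dim_row G \<Longrightarrow> {\<omega> \<in> space M. X t \<omega> = s} \<in> sets M"
  using measurable_sets[OF measurable_state[of t], of "{s}"]
  by (simp add: vimage_def Int_def conj_commute)

lemma absorption_time_measurable:
  assumes s: "s < dim_row G"
  shows "absorption_time X s \<in> borel_measurable M"
proof (rule borel_measurableI_less)
  fix a :: ereal
  let ?Q = "{q \<in> \<rat>. 0 \<le> q \<and> ereal q < a}"
  have "{\<omega> \<in> space M. absorption_time X s \<omega> < a} = (\<Union>q\<in>?Q. {\<omega> \<in> space M. X q \<omega> = s})"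
  proof (intro equalityI subsetI)
    fix \<omega> assume "\<omega> \<in> {\<omega> \<in> space M. absorption_time X s \<omega> < a}"
    then obtain p where p: "\<omega> \<in> space M" "0 \<le> p" "X p \<omega> = s" "ereal p < a"
      by (auto simp: absorption_time_def INF_less_iff)
    obtain b where b: "b > p" "\<And>v. p < v \<Longrightarrow> v < b \<Longrightarrow> X v \<omega> = X p \<omega>"
      using right_continuous_discrete[OF right_continuous[OF p(1,2)]] by blast
    obtain c where c: "p < c" "ereal c \<le> a"
      using p(4) by (cases a) (auto intro: that[of "p + 1"])
    obtain q where q: "q \<in> \<rat>" "p < q" "q < min b c" using Rats_dense_in_real[of p "min b c"] b c by auto
    have "q \<in> ?Q" using q p c by (auto intro: less_le_trans[of _ "ereal c"])
    moreover have "X q \<omega> = s" using b q p by auto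
    ultimately show "\<omega> \<in> (\<Union>q\<in>?Q. {\<omega> \<in> space M. X q \<omega> = s})" using p by blast
  next
    fix \<omega> assume "\<omega> \<in> (\<Union>q\<in>?Q. {\<omega> \<in> space M. X q \<omega> = s})"
    then show "\<omega> \<in> {\<omega> \<in> space M. absorption_time X s \<omega> < a}"
      by (auto simp: absorption_time_def INF_less_iff)
  qed
  also have "\<dots> \<in> sets M"
    using s by (intro sets.countable_UN' countable_subset[OF _ countable_rat]) auto
  finally show "{\<omega> \<in> space M. absorption_time X s \<omega> < a} \<in> sets M" .
qed

lemma prob_two_times:
  assumes ij: "i < dim_row G" "j < dim_row G" and pq: "0 \<le> p" "p < q"
  shows "\<P>(\<omega> in M. X q \<omega> = j \<and> X p \<omega> = i) = \<P>(\<omega> in M. X p \<omega> = i) * transition_prob G (q - p) i j"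
proof (cases "\<P>(\<omega> in M. X p \<omega> = i) = 0")
  case True
  have "\<P>(\<omega> in M. X q \<omega> = j \<and> X p \<omega> = i) \<le> \<P>(\<omega> in M. X p \<omega> = i)"
    using pq ij by (intro finite_measure_mono) auto
  then show ?thesis using True by (simp add: measure_le_0_iff)
next
  case False
  then have pos: "0 < \<P>(\<omega> in M. X p \<omega> = i)" by (simp add: zero_less_measure_iff)
  have "\<P>(\<omega> in M. X q \<omega> = j \<bar> X p \<omega> = i) = transition_prob G (q - p) i j"
    using markov[of "\<lambda>k. if k = 0 then p else q + real k - 1" 0 "\<lambda>k. if k = 0 then i else j"] ij pq pos by simp
  then show ?thesis using pos by (simp add: cond_prob_def field_simps)
qed

context
  fixes s
  assumes s: "s < dim_row G" and absorbing: "\<And>t. transition_prob G t s s = 1"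
begin

lemma AE_absorbed:
  assumes "0 \<le> p" "p < q"
  shows "AE \<omega> in M. X p \<omega> = s \<longrightarrow> X q \<omega> = s"
proof -
  let ?A = "{\<omega> \<in> space M. X p \<omega> = s}" and ?B = "{\<omega> \<in> space M. X q \<omega> = s}"
  have sets: "?A \<in> sets M" "?B \<in> sets M" using assms s by auto
  have "prob (?A \<inter> ?B) = prob ?A"
    using prob_two_times[OF s s assms] absorbing by (simp add: Int_def conj_ac cong: conj_cong)
  then have "prob (?A - ?B) = 0"
    using sets finite_measure_Diff'[OF sets] by simp
  then have "AE \<omega> in M. \<omega> \<notin> ?A - ?B" using sets by (subst (asm) prob_eq_0) auto
  then show ?thesis using AE_space by eventually_elim auto
qed

lemma prob_absorption_time_le:
  assumes "0 \<le> t"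
  shows "\<P>(\<omega> in M. absorption_time X s \<omega> \<le> ereal t) = \<P>(\<omega> in M. X t \<omega> = s)"
proof (rule prob_eq_AE)
  have "AE \<omega> in M. \<forall>p\<in>\<rat> \<inter> {0..}. \<forall>q\<in>\<rat> \<inter> {p<..}. X p \<omega> = s \<longrightarrow> X q \<omega> = s"
    unfolding AE_ball_countable[OF countable_Int1[OF countable_rat]] using AE_absorbed by auto
  then show "AE \<omega> in M. (absorption_time X s \<omega> \<le> ereal t) = (X t \<omega> = s)"
    using AE_space
  proof eventually_elim
    case (elim \<omega>)
    show ?case unfolding absorption_time_def
      by (rule first_visit_le_iff) (use elim right_continuous assms in auto)
  qed
qed (use assms s absorption_time_measurable[OF s] in auto)

end
end

theorem theorem1p1:
  fixes d :: nat
    and lam mu :: "nat \<Rightarrow> real"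
    and G :: "real mat"
    and M :: "'a measure"
    and X :: "real \<Rightarrow> 'a \<Rightarrow> nat"
  assumes d: "1 \<le> d"
    and G: "G = birth_death_generator d lam mu"
    and boundary: "mu 0 = 0" "lam d = 0"
    and absorbing: "\<forall>j\<le>d. G $$ (d, j) = 0"
    and birth_pos: "\<forall>i. 0 \<le> i \<and> i \<le> d - 1 \<longrightarrow> 0 < lam i"
    and death_pos: "\<forall>i. 1 \<le> i \<and> i \<le> d - 1 \<longrightarrow> 0 < mu i"
    and chain: "markov_chain M G X"
    and start: "AE \<omega> in M. X 0 \<omega> = 0"
  shows "\<exists>r :: nat \<Rightarrow> real.
      {#complex_of_real (r k). k \<in># mset_set {..<d}#} = filter_mset (\<lambda>z. z \<noteq> 0) (eigenvalues_mset (- G)) \<and>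
      (\<forall>k<d. 0 < r k) \<and>
      (\<exists>(N :: (nat \<Rightarrow> real) measure) (E :: nat \<Rightarrow> (nat \<Rightarrow> real) \<Rightarrow> real).
         prob_space N \<and>
         prob_space.indep_vars N (\<lambda>_. borel) E {..<d} \<and>
         (\<forall>k<d. distributed N lborel (E k) (exponential_density (r k))) \<and>
         absorption_time X d \<in> borel_measurable M \<and>
         distr M borel (absorption_time X d) = distr N borel (\<lambda>x. ereal (\<Sum>k<d. E k x)))"
proof -
  interpret markov_chain M G X by fact
  have Gc: "G \<in> carrier_mat (Suc d) (Suc d)" by (simp add: G birth_death_generator_carrier)
  then have dim: "dim_row G = Suc d" by simp
  have l: "0 < lam i" if "i < d" for i using birth_pos that by simp
  have m: "0 < mu i" if "0 < i" "i < d" for i using death_pos that by simp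
  have md: "mu d = 0"
    using absorbing[rule_format, of "d - 1"] d by (auto simp: G birth_death_generator_def split: if_splits)
  let ?q = "map_poly complex_of_real (bd_poly lam mu d)"
  obtain r where roots: "proots ?q = {#complex_of_real (r k). k \<in># mset_set {..<d}#}"
    and r: "\<And>k. k < d \<Longrightarrow> 0 < r k" and factor: "bd_poly lam mu d = (\<Prod>k<d. [:- r k, 1:])"
    using real_rooted_factorization[of "bd_poly lam mu d" "\<lambda>x. 0 < x",
        OF bd_poly_root_positive[of mu d lam, OF boundary(1) l m] lead_coeff_bd_poly]
    unfolding degree_bd_poly by blast
  interpret map_poly: map_poly_comm_ring_hom complex_of_real ..
  have eigenvalues: "eigenvalues_mset (- G) = add_mset 0 (proots ?q)"
  proof -
    obtain e where e: "d = Suc e" using d by (cases d) auto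
    have "bd_poly lam mu (Suc d) = [:0, 1:] * bd_poly lam mu d"
      using boundary md unfolding e by simp
    moreover have "char_poly (map_mat complex_of_real (- G)) = map_poly complex_of_real (char_poly (- G))"
      by (rule of_real_hom.char_poly_hom[of _ "Suc d"]) (use Gc in simp)
    ultimately have "char_poly (map_mat complex_of_real (- G)) = [:0, 1:] * ?q"
      unfolding G char_poly_uminus_birth_death_generator by (simp only: map_poly.hom_mult) simp
    moreover have "coeff ?q d = 1"
      using lead_coeff_bd_poly[of lam mu d] by (simp add: coeff_map_poly degree_bd_poly)
    then have "?q \<noteq> 0" by auto
    ultimately show ?thesis by (simp add: eigenvalues_mset_def proots_mult del: mult_pCons_left)
  qed
  have nonzero: "{#complex_of_real (r k). k \<in># mset_set {..<d}#} = filter_mset (\<lambda>z. z \<noteq> 0) (eigenvalues_mset (- G))"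
  proof -
    have "filter_mset (\<lambda>z. z \<noteq> 0) {#complex_of_real (r k). k \<in># mset_set {..<d}#} =
        filter_mset (\<lambda>_. True) {#complex_of_real (r k). k \<in># mset_set {..<d}#}"
      by (rule filter_mset_cong) (auto dest: r)
    then show ?thesis by (simp add: eigenvalues roots)
  qed
  obtain N :: "(nat \<Rightarrow> real) measure" where N: "prob_space N"
    and indep: "prob_space.indep_vars N (\<lambda>_. borel) (\<lambda>k x. x k) {..<d}"
    and dist: "\<And>k. k < d \<Longrightarrow> distributed N lborel (\<lambda>x. x k) (exponential_density (r k))"
    using exists_indep_exponentials[of "{..<d}" r] r d by (auto simp: lessThan_empty_iff)
  obtain g where g0: "g 0 = (\<lambda>t. transition_prob G t 0 d)"
    and g: "\<And>t. g d t = 1" "\<And>k. k < d \<Longrightarrow> g k 0 = 0"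
      "\<And>k t. k < d \<Longrightarrow> (g k has_real_derivative r k * (g (Suc k) t - g k t)) (at t)"
    using transition_prob_factorization[of mu lam d r, OF boundary md l r factor] unfolding G by blast
  interpret N: prob_space N by fact
  have sum_cdf: "N.prob {x \<in> space N. (\<Sum>k<d. x k) \<le> t} = (if t < 0 then 0 else transition_prob G t 0 d)" for t
    using N.sum_exponential_cdf[OF r indep dist g, of 0 t] by (simp add: g0 lessThan_atLeast0)
  have comp [measurable]: "(\<lambda>x. x k) \<in> borel_measurable N" if "k < d" for k
    using dist[OF that] by (simp add: distributed_def)
  have sum_meas [measurable]: "(\<lambda>x. ereal (\<Sum>k<d. x k)) \<in> borel_measurable N"
    by (intro borel_measurable_ereal borel_measurable_sum) (simp add: comp)
  have stays: "transition_prob G t d d = 1" for t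
    using absorbing by (intro transition_prob_absorbing_state[OF Gc]) auto
  note T_meas [measurable] = absorption_time_measurable[of d, unfolded dim, simplified]
  have at_d: "\<P>(\<omega> in M. X t \<omega> = d) = transition_prob G t 0 d" if "0 \<le> t" for t
  proof (cases "t = 0")
    case True
    have "\<P>(\<omega> in M. X 0 \<omega> = d) = 0"
      by (rule prob_eq_0_AE) (use start d in \<open>auto elim!: eventually_mono\<close>)
    then show ?thesis using g(2)[of 0] d True by (simp add: g0)
  next
    case False
    have sets0: "{\<omega> \<in> space M. X 0 \<omega> = 0} \<in> events" using state_sets[of 0 0] dim by simp
    have "\<P>(\<omega> in M. X 0 \<omega> = 0) = 1" using start sets0 by (subst prob_Collect_eq_1) auto
    moreover have "\<P>(\<omega> in M. X t \<omega> = d \<and> X 0 \<omega> = 0) = \<P>(\<omega> in M. X t \<omega> = d)"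
      using start that dim by (intro prob_eq_AE) auto
    ultimately show ?thesis using prob_two_times[of 0 d 0 t] False that dim by simp
  qed
  have T_cdf: "\<P>(\<omega> in M. absorption_time X d \<omega> \<le> ereal t) = (if t < 0 then 0 else transition_prob G t 0 d)" for t
  proof (cases "t < 0")
    case True
    have "\<not> absorption_time X d \<omega> \<le> ereal t" for \<omega>
      using True order_trans[OF absorption_time_nonneg, of X d \<omega> "ereal t"] by auto
    then show ?thesis using True by simp
  next
    case False
    then show ?thesis using prob_absorption_time_le[of d t] at_d[of t] stays dim by simp
  qed
  have "distr M borel (absorption_time X d) = distr N borel (\<lambda>x. ereal (\<Sum>k<d. x k))"
  proof (rule ereal_measure_eqI)
    show "prob_space (distr M borel (absorption_time X d))" by (rule prob_space_distr) simp
    fix a :: ereal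
    have "prob {\<omega> \<in> space M. absorption_time X d \<omega> \<le> a} = N.prob {x \<in> space N. ereal (\<Sum>k<d. x k) \<le> a}"
    proof (cases a)
      case (real t)
      then show ?thesis by (simp only: T_cdf ereal_less_eq sum_cdf)
    next
      case MInf
      have "\<not> absorption_time X d \<omega> \<le> - \<infinity>" for \<omega>
        using order_trans[OF absorption_time_nonneg, of X d \<omega> "- \<infinity>"] by auto
      then show ?thesis using MInf by simp
    qed (simp add: prob_space N.prob_space)
    then show "emeasure (distr M borel (absorption_time X d)) {..a} =
        emeasure (distr N borel (\<lambda>x. ereal (\<Sum>k<d. x k))) {..a}"
      by (simp add: emeasure_distr emeasure_eq_measure N.emeasure_eq_measure vimage_def Int_def conj_commute)
  qed simp_all
  then show ?thesis using nonzero r N indep dist T_meas by blast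
qed

end
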